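(* Let $\mu\ge 1$, $0\le\gamma<1$, $-1\le B<A\le 1$, $-1\le B<0$, and let $k\ge m$ be non-negative integers. Let $\Phi_\mu(z)=z+\sum_{n=2}^\infty\vartheta_n z^{\mu n}$ and $\Psi_\mu(z)=z+\sum_{n=2}^\infty\lambda_n z^{\mu n}$ (series converging in $\mathbb U$) with $\vartheta_n\ge 0$, $\lambda_n\ge 0$, $\vartheta_n\ge\lambda_n$ for all $n\ge 2$. If $F_\mu(z)=z-\sum_{n=2}^\infty a_nz^{\mu n}\in\mathcal X_\mu$ (so $a_n\ge0$) satisfies $$\sum_{n=2}^{\infty}\Big[(1-B)\big((\mu n)^k\vartheta_n-(\mu n)^m\lambda_n\big)+(A-B)(1-\gamma)(\mu n)^m\vartheta_n\Big]a_n\le (A-B)(1-\gamma),$$ then $F_\mu\in\widetilde{\mathcal E}_{k,m}(\Phi_\mu,\Psi_\mu,A,B,\mu,\gamma)$.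
   Context: $\mathbb U=\{z\in\mathbb C:|z|<1\}$. For real $\mu\ge1$, powers $z^{s}$ with $s>0$ are taken with the principal branch for $z\ne0$, and equal $0$ at $z=0$. $\mathcal A_\mu$ is the class of functions $F_\mu(z)=z+\sum_{n=2}^\infty a_nz^{\mu n}$ ($a_n\in\mathbb C$) whose series converges in $\mathbb U$; $\mathcal X_\mu$ is the subclass of functions of the form $F_\mu(z)=z-\sum_{n=2}^\infty a_nz^{\mu n}$ with all $a_n\ge0$. For $F_\mu(z)=z+\sum_{n\ge2}a_nz^{\mu n}$ and $G_\mu(z)=z+\sum_{n\ge2}b_nz^{\mu n}$ the convolution is $(F_\mu*G_\mu)(z)=z+\sum_{n\ge2}a_nb_nz^{\mu n}$. For a non-negative integer $\beta$ the operator $D_\mu^\beta$ is $D_\mu^\beta F_\mu(z)=z+\sum_{n=2}^\infty(\mu n)^\beta a_nz^{\mu n}$. A function $F_\mu\in\mathcal A_\mu$ belongs to $\mathcal E_{k,m}(\Phi_\mu,\Psi_\mu,A,B,\mu,\gamma)$ if, for all $z$ with $0<|z|<1$, $(F_\mu*\Psi_\mu)(z)\neq0$, $D_\mu^m(F_\mu*\Psi_\mu)(z)\ne0$, and the quotient $q(z)=\dfrac{D_\mu^k(F_\mu*\Phi_\mu)(z)}{D_\mu^m(F_\mu*\Psi_\mu)(z)}$ satisfies $$\left|\frac{q(z)-1}{(A-B)(1-\gamma)-B\,(q(z)-1)}\right|<1,$$ with the denominator non-zero. (This is the inequality form of the subordination $q(z)\prec(1-\gamma)\frac{1+Az}{1+Bz}+\gamma$.)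 Finally $\widetilde{\mathcal E}_{k,m}(\Phi_\mu,\Psi_\mu,A,B,\mu,\gamma)=\mathcal E_{k,m}(\Phi_\mu,\Psi_\mu,A,B,\mu,\gamma)\cap\mathcal X_\mu$. *)

theory Defs
  imports "HOL-Analysis.Analysis"
begin

text \<open>Functions on the open unit disc are total functions of type complex to complex; their values
  outside the disc are irrelevant. The library's powr uses the principal branch of the
  logarithm (argument in the half-open interval from -pi, excluded, to pi) and satisfies
  0 powr s = 0. Series starting at n = 2 are written with the index shift n + 2, so the entries
  of index 0 and 1 of a coefficient sequence are irrelevant.\<close>

definition mu_expansion :: "real \<Rightarrow> (nat \<Rightarrow> complex) \<Rightarrow> (complex \<Rightarrow> complex) \<Rightarrow> bool" where
  "mu_expansion \<mu> c F \<longleftrightarrow>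
     (\<forall>z. norm z < 1 \<longrightarrow>
        (\<lambda>n. c (n + 2) * z powr of_real (\<mu> * real (n + 2))) sums (F z - z))"

definition class_A :: "real \<Rightarrow> (complex \<Rightarrow> complex) set" where
  "class_A \<mu> = {F. \<exists>c. mu_expansion \<mu> c F}"

definition class_X :: "real \<Rightarrow> (complex \<Rightarrow> complex) set" where
  "class_X \<mu> = {F. \<exists>a :: nat \<Rightarrow> real.
     (\<forall>n\<ge>2. 0 \<le> a n) \<and> mu_expansion \<mu> (\<lambda>n. - of_real (a n)) F}"

text \<open>The coefficients of a function in the class A; they are unique by the lemma
  mu_coeff_eq below.\<close>

definition mu_coeff :: "real \<Rightarrow> (complex \<Rightarrow> complex) \<Rightarrow> nat \<Rightarrow> complex" where
  "mu_coeff \<mu> F = (THE c. c 0 = 0 \<and> c 1 = 0 \<and> mu_expansion \<mu> c F)"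

definition mu_conv ::
    "real \<Rightarrow> (complex \<Rightarrow> complex) \<Rightarrow> (complex \<Rightarrow> complex) \<Rightarrow> complex \<Rightarrow> complex" where
  "mu_conv \<mu> F G z =
     z + (\<Sum>n. mu_coeff \<mu> F (n + 2) * mu_coeff \<mu> G (n + 2) * z powr of_real (\<mu> * real (n + 2)))"

definition mu_D :: "real \<Rightarrow> nat \<Rightarrow> (complex \<Rightarrow> complex) \<Rightarrow> complex \<Rightarrow> complex" where
  "mu_D \<mu> \<beta> F z =
     z + (\<Sum>n. of_real ((\<mu> * real (n + 2)) ^ \<beta>) * mu_coeff \<mu> F (n + 2)
              * z powr of_real (\<mu> * real (n + 2)))"

definition class_E ::
    "nat \<Rightarrow> nat \<Rightarrow> (complex \<Rightarrow> complex) \<Rightarrow> (complex \<Rightarrow> complex) \<Rightarrow> real \<Rightarrow> real \<Rightarrow> real \<Rightarrow> real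
      \<Rightarrow> (complex \<Rightarrow> complex) set" where
  "class_E k m \<Phi> \<Psi> A B \<mu> \<gamma> =
     {F \<in> class_A \<mu>. \<forall>z. 0 < norm z \<and> norm z < 1 \<longrightarrow>
        mu_conv \<mu> F \<Psi> z \<noteq> 0 \<and>
        mu_D \<mu> m (mu_conv \<mu> F \<Psi>) z \<noteq> 0 \<and>
        (let q = mu_D \<mu> k (mu_conv \<mu> F \<Phi>) z / mu_D \<mu> m (mu_conv \<mu> F \<Psi>) z;
             d = of_real ((A - B) * (1 - \<gamma>)) - of_real B * (q - 1)
         in d \<noteq> 0 \<and> norm ((q - 1) / d) < 1)}"

definition class_E_tilde ::
    "nat \<Rightarrow> nat \<Rightarrow> (complex \<Rightarrow> complex) \<Rightarrow> (complex \<Rightarrow> complex) \<Rightarrow> real \<Rightarrow> real \<Rightarrow> real \<Rightarrow> real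
      \<Rightarrow> (complex \<Rightarrow> complex) set" where
  "class_E_tilde k m \<Phi> \<Psi> A B \<mu> \<gamma> = class_E k m \<Phi> \<Psi> A B \<mu> \<gamma> \<inter> class_X \<mu>"


lemma class_X_subset_class_A: "class_X \<mu> \<subseteq> class_A \<mu>"
  by (auto simp: class_X_def class_A_def)

lemma powr_mu_real:
  assumes "0 < s" "1 \<le> \<mu>"
  shows "complex_of_real (s powr (1 / \<mu>)) powr of_real (\<mu> * real n) = of_real s ^ n"
proof -
  have "complex_of_real (s powr (1 / \<mu>)) powr of_real (\<mu> * real n)
      = of_real ((s powr (1 / \<mu>)) powr (\<mu> * real n))"
    by (subst powr_of_real) auto
  also have "(s powr (1 / \<mu>)) powr (\<mu> * real n) = s ^ n"
    using assms by (simp add: powr_powr powr_realpow)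
  finally show ?thesis by simp
qed

lemma mu_expansion_real:
  assumes "mu_expansion \<mu> c F" "1 \<le> \<mu>" "0 < s" "s < 1"
  shows "(\<lambda>n. c (n + 2) * of_real s ^ (n + 2)) sums
           (F (of_real (s powr (1 / \<mu>))) - of_real (s powr (1 / \<mu>)))"
proof -
  have "s powr (1 / \<mu>) < 1 powr (1 / \<mu>)"
    by (rule powr_less_mono2) (use assms(2-4) in auto)
  then have "norm (complex_of_real (s powr (1 / \<mu>))) < 1" by simp
  with assms(1) have "(\<lambda>n. c (n + 2) * complex_of_real (s powr (1 / \<mu>)) powr of_real (\<mu> * real (n + 2)))
      sums (F (of_real (s powr (1 / \<mu>))) - of_real (s powr (1 / \<mu>)))"
    unfolding mu_expansion_def by blast
  then show ?thesis
    by (simp only: powr_mu_real[OF assms(3,2)])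
qed

lemma power_series_real_zero:
  fixes e :: "nat \<Rightarrow> complex"
  assumes "\<And>s::real. 0 < s \<Longrightarrow> s < 1 \<Longrightarrow> (\<lambda>n. e n * of_real s ^ n) sums 0"
  shows "e n = 0"
proof (induction n rule: less_induct)
  case (less m)
  define g where "g x = (\<Sum>n. e (n + m) * x ^ n)" for x :: complex
  have z: "(\<lambda>n. e (n + m) * of_real s ^ n) sums 0" if s: "0 < s" "s < 1" for s :: real
  proof -
    have "(\<lambda>n. e (n + m) * of_real s ^ (n + m)) sums (0 - (\<Sum>i<m. e i * of_real s ^ i))"
      by (rule sums_split_initial_segment[OF assms[OF s]])
    also have "(\<Sum>i<m. e i * of_real s ^ i) = 0"
      using less by simp
    finally have "(\<lambda>n. (e (n + m) * of_real s ^ n) * of_real s ^ m) sums 0"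
      by (simp add: power_add mult.assoc)
    from sums_divide[OF this, of "of_real s ^ m"] s show ?thesis by simp
  qed
  have "(g \<longlongrightarrow> e (0 + m)) (at 0)"
  proof (rule powser_limit_0[where s = "1/2" and a = "\<lambda>n. e (n + m)"])
    fix x :: complex assume x: "norm x < 1/2"
    have "summable (\<lambda>n. e (n + m) * x ^ n)"
      by (rule powser_inside[OF sums_summable[OF z[of "1/2"]]]) (use x in auto)
    then show "(\<lambda>n. e (n + m) * x ^ n) sums g x"
      unfolding g_def by (rule summable_sums)
  qed simp
  moreover have "filterlim (\<lambda>n. complex_of_real (inverse (real (Suc (Suc n))))) (at 0) sequentially"
    unfolding filterlim_at
  proof
    show "(\<lambda>n. complex_of_real (inverse (real (Suc (Suc n))))) \<longlonglongrightarrow> 0"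
      using tendsto_of_real[OF LIMSEQ_Suc[OF LIMSEQ_inverse_real_of_nat], where 'a = complex]
      by simp
  qed (simp del: of_nat_Suc)
  ultimately have "(\<lambda>n. g (complex_of_real (inverse (real (Suc (Suc n)))))) \<longlonglongrightarrow> e (0 + m)"
    by (rule filterlim_compose)
  moreover have "g (complex_of_real (inverse (real (Suc (Suc n))))) = 0" for n
  proof -
    have "(\<lambda>j. e (j + m) * of_real (inverse (real (Suc (Suc n)))) ^ j) sums 0"
      by (rule z) (auto simp: field_simps)
    then show ?thesis unfolding g_def by (rule sums_unique[symmetric])
  qed
  ultimately have "(\<lambda>_::nat. 0) \<longlonglongrightarrow> e (0 + m)" by (simp only:)
  from LIMSEQ_unique[OF this tendsto_const] show ?case by (simp only: add_0)
qed

lemma mu_expansion_unique: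
  assumes "mu_expansion \<mu> c F" "mu_expansion \<mu> d F" "1 \<le> \<mu>" "2 \<le> n"
  shows "c n = d n"
proof -
  have "(\<lambda>n. (c (n + 2) - d (n + 2)) * of_real s ^ n) sums 0" if s: "0 < s" "s < 1" for s :: real
  proof -
    have "(\<lambda>n. c (n + 2) * of_real s ^ (n + 2) - d (n + 2) * of_real s ^ (n + 2)) sums 0"
      using sums_diff[OF mu_expansion_real[OF assms(1,3) s] mu_expansion_real[OF assms(2,3) s]]
      by simp
    then have "(\<lambda>n. (c (n + 2) - d (n + 2)) * of_real s ^ n * of_real s ^ 2) sums 0"
      by (simp only: power_add left_diff_distrib mult.assoc)
    from sums_divide[OF this, of "of_real s ^ 2"] s show ?thesis by simp
  qed
  from power_series_real_zero[of "\<lambda>n. c (n + 2) - d (n + 2)", OF this, of "n - 2"] assms(4)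
  show ?thesis by (simp only: le_add_diff_inverse2 right_minus_eq)
qed

lemma mu_coeff_eq:
  assumes "mu_expansion \<mu> c F" "1 \<le> \<mu>" "2 \<le> n"
  shows "mu_coeff \<mu> F n = c n"
proof -
  let ?c = "\<lambda>n. if n < 2 then 0 else c n"
  have e: "mu_expansion \<mu> ?c F" using assms(1) unfolding mu_expansion_def by simp
  have "mu_coeff \<mu> F = ?c"
    unfolding mu_coeff_def
  proof (rule the_equality)
    fix d assume d: "d 0 = 0 \<and> d 1 = 0 \<and> mu_expansion \<mu> d F"
    show "d = ?c"
    proof
      fix j show "d j = ?c j"
        using d mu_expansion_unique[OF _ e assms(2), of d j] by (cases "j < 2") (auto simp: less_2_cases_iff)
    qed
  qed (use e in auto)
  then show ?thesis using assms(3) by simp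
qed

lemma norm_powr_mu:
  assumes "z \<noteq> 0"
  shows "norm (z powr complex_of_real (\<mu> * real n)) = (norm z powr \<mu>) ^ n"
proof -
  have "norm (z powr complex_of_real (\<mu> * real n)) = norm z powr (\<mu> * real n)"
    by (subst norm_powr_real_powr') auto
  also have "\<dots> = (norm z powr \<mu>) powr real n" by (simp only: powr_powr)
  also have "\<dots> = (norm z powr \<mu>) ^ n" by (rule powr_realpow) (use assms in simp)
  finally show ?thesis .
qed

lemma mu_expansion_abs_summable:
  assumes "mu_expansion \<mu> c F" "1 \<le> \<mu>" "0 \<le> s" "s < 1"
  shows "summable (\<lambda>n. norm (c (n + 2)) * s ^ n)"
proof -
  define r where "r = (s + 1) / 2"
  have r: "0 < r" "r < 1" "s < r" using assms by (auto simp: r_def)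
  have "summable (\<lambda>n. (c (n + 2) * of_real r ^ n) * of_real r ^ 2)"
    using sums_summable[OF mu_expansion_real[OF assms(1,2) r(1,2)]]
    by (simp only: power_add mult.assoc)
  from summable_divide[OF this, of "of_real r ^ 2"] r
  have "summable (\<lambda>n. c (n + 2) * of_real r ^ n)" by simp
  from powser_insidea[OF this, of "of_real s"] r assms show ?thesis
    by (simp add: norm_mult norm_power)
qed

lemma mu_expansionI:
  assumes s: "\<And>s::real. 0 \<le> s \<Longrightarrow> s < 1 \<Longrightarrow> summable (\<lambda>n. norm (c (n + 2)) * s ^ n)"
    and "1 \<le> \<mu>"
    and F: "\<And>z. norm z < 1 \<Longrightarrow> F z = z + (\<Sum>n. c (n + 2) * z powr of_real (\<mu> * real (n + 2)))"
  shows "mu_expansion \<mu> c F"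
  unfolding mu_expansion_def
proof (intro allI impI)
  fix z :: complex assume z: "norm z < 1"
  have "summable (\<lambda>n. c (n + 2) * z powr of_real (\<mu> * real (n + 2)))"
  proof (cases "z = 0")
    case False
    let ?r = "norm z powr \<mu>"
    have "?r < 1 powr \<mu>"
      by (rule powr_less_mono2) (use z assms(2) in auto)
    then have "summable (\<lambda>n. norm (c (n + 2)) * ?r ^ n * ?r ^ 2)"
      by (intro summable_mult2 s) auto
    then show ?thesis
      by (intro summable_norm_cancel[where f = "\<lambda>n. c (n + 2) * z powr of_real (\<mu> * real (n + 2))"])
        (simp only: norm_mult norm_powr_mu[OF False] power_add mult.assoc)
  qed simp
  from summable_sums[OF this] F[OF z]
  show "(\<lambda>n. c (n + 2) * z powr of_real (\<mu> * real (n + 2))) sums (F z - z)" by simp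
qed

lemma abs_summable_product:
  fixes u v :: "nat \<Rightarrow> real"
  assumes "\<And>s. 0 \<le> s \<Longrightarrow> s < 1 \<Longrightarrow> summable (\<lambda>n. u n * s ^ n)"
    and "\<And>s. 0 \<le> s \<Longrightarrow> s < 1 \<Longrightarrow> summable (\<lambda>n. v n * s ^ n)"
    and "\<And>n. 0 \<le> u n" "\<And>n. 0 \<le> v n" and "0 \<le> s" "s < 1"
  shows "summable (\<lambda>n. u n * v n * s ^ n)"
proof -
  define r where "r = sqrt s"
  have r: "0 \<le> r" "r < 1" "s = r * r" using assms(5,6) by (auto simp: r_def)
  have "Bseq (\<lambda>n. u n * r ^ n)"
    by (rule convergent_imp_Bseq[OF convergentI[OF summable_LIMSEQ_zero[OF assms(1)[OF r(1,2)]]]])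
  then obtain K where K: "\<And>n. norm (u n * r ^ n) \<le> K" by (auto simp: Bseq_def)
  show ?thesis
  proof (rule summable_comparison_test')
    show "summable (\<lambda>n. K * (v n * r ^ n))" by (intro summable_mult assms(2) r)
    fix n
    have "norm (u n * v n * s ^ n) = norm (u n * r ^ n) * (v n * r ^ n)"
      using assms(3,4) r by (simp add: power_mult_distrib abs_mult)
    also have "\<dots> \<le> K * (v n * r ^ n)"
      using K assms(4) r by (intro mult_right_mono) auto
    finally show "norm (u n * v n * s ^ n) \<le> K * (v n * r ^ n)" .
  qed
qed

lemma mu_expansion_conv:
  assumes "mu_expansion \<mu> c F" "mu_expansion \<mu> d G" "1 \<le> \<mu>"
  shows "mu_expansion \<mu> (\<lambda>n. c n * d n) (mu_conv \<mu> F G)"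
proof (rule mu_expansionI[OF _ assms(3)])
  fix s :: real assume s: "0 \<le> s" "s < 1"
  show "summable (\<lambda>n. norm (c (n + 2) * d (n + 2)) * s ^ n)"
    unfolding norm_mult
    by (rule abs_summable_product) (use s assms mu_expansion_abs_summable in auto)
next
  fix z :: complex
  show "mu_conv \<mu> F G z = z + (\<Sum>n. c (n + 2) * d (n + 2) * z powr of_real (\<mu> * real (n + 2)))"
    unfolding mu_conv_def
    by (simp only: mu_coeff_eq[OF assms(1,3) le_add2] mu_coeff_eq[OF assms(2,3) le_add2])
qed

lemma summable_linear:
  fixes s :: real
  assumes "0 \<le> s" "s < 1" "0 \<le> \<mu>"
  shows "summable (\<lambda>n. (\<mu> * real (n + 2)) * s ^ n)"
proof -
  have "summable (\<lambda>n. diffs (\<lambda>_. 1) n * s ^ n)"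
    by (rule termdiff_converges[where K = 1]) (use assms in \<open>auto intro: summable_geometric\<close>)
  then have "summable (\<lambda>n. real (Suc n) * s ^ n)" by (simp add: diffs_def)
  moreover have "summable (\<lambda>n. s ^ n)" using assms by (intro summable_geometric) auto
  ultimately have "summable (\<lambda>n. \<mu> * (real (Suc n) * s ^ n + s ^ n))"
    by (intro summable_mult summable_add)
  then show ?thesis by (simp add: algebra_simps)
qed

lemma summable_D_weights:
  fixes s :: real
  assumes "0 \<le> s" "s < 1" "0 \<le> \<mu>"
  shows "summable (\<lambda>n. (\<mu> * real (n + 2)) ^ \<beta> * s ^ n)"
  using assms
proof (induction \<beta> arbitrary: s)
  case 0
  then show ?case by (simp add: summable_geometric)
next
  case (Suc \<beta>)
  have "summable (\<lambda>n. (\<mu> * real (n + 2)) * (\<mu> * real (n + 2)) ^ \<beta> * s ^ n)"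
    by (rule abs_summable_product) (use Suc summable_linear in auto)
  then show ?case by (simp add: mult.assoc)
qed

lemma mu_expansion_D:
  assumes "mu_expansion \<mu> c F" "1 \<le> \<mu>"
  shows "mu_expansion \<mu> (\<lambda>n. of_real ((\<mu> * real n) ^ \<beta>) * c n) (mu_D \<mu> \<beta> F)"
proof (rule mu_expansionI[OF _ assms(2)])
  fix s :: real assume s: "0 \<le> s" "s < 1"
  have "summable (\<lambda>n. (\<mu> * real (n + 2)) ^ \<beta> * norm (c (n + 2)) * s ^ n)"
    by (rule abs_summable_product)
      (use s assms mu_expansion_abs_summable summable_D_weights in auto)
  moreover have "norm (complex_of_real ((\<mu> * real (n + 2)) ^ \<beta>) * c (n + 2))
      = (\<mu> * real (n + 2)) ^ \<beta> * norm (c (n + 2))" for n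
    using assms(2) by (simp only: norm_mult norm_of_real) simp
  ultimately show "summable (\<lambda>n. norm (complex_of_real ((\<mu> * real (n + 2)) ^ \<beta>) * c (n + 2)) * s ^ n)"
    by simp
next
  fix z :: complex
  show "mu_D \<mu> \<beta> F z = z + (\<Sum>n. of_real ((\<mu> * real (n + 2)) ^ \<beta>) * c (n + 2)
      * z powr of_real (\<mu> * real (n + 2)))"
    unfolding mu_D_def by (simp only: mu_coeff_eq[OF assms le_add2])
qed

end

theory Submission
  imports Defs
begin

text \<open>The quotient condition is homogeneous: writing \<open>N\<close> and \<open>M\<close> for numerator and
  denominator of \<open>q\<close> and \<open>c = (A - B) (1 - \<gamma>)\<close>, it compares the norm of \<open>N - M\<close> with that of
  \<open>c M - B (N - M)\<close>, and since \<open>B\<close> is negative the triangle inequality reduces it to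
  \<open>(1 - B) |N - M| < c |M|\<close> (lemma \<open>janowski_quotient_bound\<close>).

  The functions \<open>M\<close> and \<open>N\<close> have real coefficients: \<open>M = z - \<Sum> Q\<^sub>n z\<^sup>\<mu>\<^sup>n\<close> and
  \<open>N - M = - \<Sum> (P\<^sub>n - Q\<^sub>n) z\<^sup>\<mu>\<^sup>n\<close>, where \<open>P\<^sub>n = (\<mu>n)\<^sup>k a\<^sub>n \<theta>\<^sub>n\<close> and
  \<open>Q\<^sub>n = (\<mu>n)\<^sup>m a\<^sub>n l\<^sub>n\<close>; here \<open>P\<^sub>n \<ge> Q\<^sub>n \<ge> 0\<close> because \<open>m \<le> k\<close>, \<open>l\<^sub>n \<le> \<theta>\<^sub>n\<close> and \<open>\<mu>n \<ge> 1\<close>. Every power occurring in a tail has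
  exponent at least 2, so a tail is at most \<open>|z|\<^sup>2\<close> times the sum of its coefficients
  (lemma \<open>norm_tail_le\<close>). Therefore
  \<open>c |M| - (1 - B) |N - M| \<ge> c |z| - |z|\<^sup>2 (c \<Sum> Q\<^sub>n + (1 - B) \<Sum> (P\<^sub>n - Q\<^sub>n))\<close>. The last bracket is
  at most \<open>c\<close> by the coefficient hypothesis, because \<open>l\<^sub>n \<le> \<theta>\<^sub>n\<close>; what remains is
  \<open>c (|z| - |z|\<^sup>2)\<close>, which is positive in the punctured disc. The same hypothesis gives
  \<open>\<Sum> Q\<^sub>n \<le> 1\<close>, hence also \<open>\<Sum> a\<^sub>n l\<^sub>n \<le> 1\<close>, so that neither \<open>M\<close> nor \<open>F * \<Psi>\<close> vanishes in the
  punctured disc (lemma \<open>mu_expansion_nonzero\<close>).\<close>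

lemma norm_powr_mu_le_square:
  assumes "1 \<le> \<mu>" "0 < norm z" "norm z < 1" "2 \<le> n"
  shows "norm (z powr complex_of_real (\<mu> * real n)) \<le> norm z ^ 2"
proof -
  have "norm z powr \<mu> \<le> norm z powr 1"
    by (rule powr_mono') (use assms in auto)
  then have le: "norm z powr \<mu> \<le> norm z" by simp
  have "norm (z powr complex_of_real (\<mu> * real n)) = (norm z powr \<mu>) ^ n"
    by (rule norm_powr_mu) (use assms in auto)
  also have "\<dots> \<le> norm z ^ n" by (rule power_mono[OF le]) simp
  also have "\<dots> \<le> norm z ^ 2" by (rule power_decreasing) (use assms in auto)
  finally show ?thesis .
qed

lemma norm_tail_le:
  fixes u :: "nat \<Rightarrow> real" and z :: complex
  assumes "1 \<le> \<mu>" "0 < norm z" "norm z < 1"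
    and nonneg: "\<And>n. 0 \<le> u n" and "u sums U"
    and w: "(\<lambda>n. - of_real (u n) * z powr of_real (\<mu> * real (n + 2))) sums w"
  shows "norm w \<le> U * norm z ^ 2"
proof -
  have le: "norm (- of_real (u n) * z powr complex_of_real (\<mu> * real (n + 2))) \<le> u n * norm z ^ 2" for n
    unfolding norm_mult norm_minus_cancel norm_of_real abs_of_nonneg[OF nonneg]
    by (rule mult_left_mono[OF norm_powr_mu_le_square nonneg]) (use assms in auto)
  have s: "(\<lambda>n. u n * norm z ^ 2) sums (U * norm z ^ 2)"
    by (rule sums_mult2) fact
  show ?thesis
    using norm_suminf_le[OF le sums_summable[OF s]] sums_unique[OF w] sums_unique[OF s] by simp
qed

text \<open>A function whose tail coefficients sum to at most 1 differs from \<open>z\<close> by at most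
  \<open>|z|\<^sup>2 < |z|\<close>.\<close>

lemma mu_expansion_nonzero:
  fixes u :: "nat \<Rightarrow> real" and z :: complex
  assumes "1 \<le> \<mu>" "0 < norm z" "norm z < 1"
    and "\<And>n. 0 \<le> u (n + 2)" and "(\<lambda>n. u (n + 2)) sums U" and "U \<le> 1"
    and exp: "mu_expansion \<mu> (\<lambda>n. - of_real (u n)) G"
  shows "G z \<noteq> 0"
proof
  assume "G z = 0"
  have "norm (G z - z) \<le> U * norm z ^ 2"
    by (rule norm_tail_le[where u = "\<lambda>n. u (n + 2)" and \<mu> = \<mu>])
      (use assms in \<open>auto simp: mu_expansion_def\<close>)
  also have "\<dots> \<le> 1 * norm z ^ 2" by (rule mult_right_mono) (use assms in auto)
  also have "\<dots> < norm z" using assms by (simp add: power2_eq_square)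
  finally show False using \<open>G z = 0\<close> by simp
qed

text \<open>Multiplying numerator and denominator of the expression by \<open>M\<close> turns it into
  \<open>(N - M) / (c M - B (N - M))\<close>, whose denominator has norm at least \<open>c |M| + B |N - M|\<close>
  for nonpositive \<open>B\<close>.\<close>

lemma janowski_quotient_bound:
  fixes M N :: complex and B c :: real
  assumes "B \<le> 0" "0 \<le> c" and less: "(1 - B) * norm (N - M) < c * norm M"
  defines "d \<equiv> of_real c - of_real B * (N / M - 1)"
  shows "d \<noteq> 0 \<and> norm ((N / M - 1) / d) < 1"
proof -
  let ?e = "of_real c * M - of_real B * (N - M)"
  have "0 \<le> (1 - B) * norm (N - M)" using assms(1) by simp
  then have M: "M \<noteq> 0" using less by auto
  have "norm (of_real c * M) - norm (of_real B * (N - M)) \<le> norm ?e"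
    by (rule norm_triangle_ineq2)
  then have "c * norm M + B * norm (N - M) \<le> norm ?e"
    using assms(1,2) by (simp add: norm_mult)
  then have e: "norm (N - M) < norm ?e" using less by (simp add: algebra_simps)
  then have e0: "?e \<noteq> 0" by auto
  have d: "d = ?e / M" and q: "N / M - 1 = (N - M) / M"
    using M by (simp_all add: d_def diff_divide_distrib right_diff_distrib)
  have "norm ((N / M - 1) / d) = norm (N - M) / norm ?e"
    using M by (simp add: d q norm_divide)
  then show ?thesis using e e0 M d by (auto simp: divide_less_eq)
qed

theorem theorem2:
  fixes \<mu> \<gamma> A B S :: real and k m :: nat
    and \<Phi> \<Psi> F :: "complex \<Rightarrow> complex"
    and \<theta> l a :: "nat \<Rightarrow> real"
  assumes "1 \<le> \<mu>"
    and "0 \<le> \<gamma>" and "\<gamma> < 1"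
    and "- 1 \<le> B" and "B < A" and "A \<le> 1" and "B < 0"
    and "m \<le> k"
    and "mu_expansion \<mu> (\<lambda>n. of_real (\<theta> n)) \<Phi>"
    and "mu_expansion \<mu> (\<lambda>n. of_real (l n)) \<Psi>"
    and "\<And>n. 2 \<le> n \<Longrightarrow> 0 \<le> \<theta> n"
    and "\<And>n. 2 \<le> n \<Longrightarrow> 0 \<le> l n"
    and "\<And>n. 2 \<le> n \<Longrightarrow> l n \<le> \<theta> n"
    and "mu_expansion \<mu> (\<lambda>n. - of_real (a n)) F"
    and "\<And>n. 2 \<le> n \<Longrightarrow> 0 \<le> a n"
    and "(\<lambda>n. ((1 - B) * ((\<mu> * real (n + 2)) ^ k * \<theta> (n + 2) - (\<mu> * real (n + 2)) ^ m * l (n + 2))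
               + (A - B) * (1 - \<gamma>) * (\<mu> * real (n + 2)) ^ m * \<theta> (n + 2)) * a (n + 2)) sums S"
    and "S \<le> (A - B) * (1 - \<gamma>)"
  shows "F \<in> class_E_tilde k m \<Phi> \<Psi> A B \<mu> \<gamma>"
proof -
  define c where "c = (A - B) * (1 - \<gamma>)"
  have c: "0 < c" using assms(3,5) by (simp add: c_def)
  define P where "P n = (\<mu> * real n) ^ k * (a n * \<theta> n)" for n
  define Q where "Q n = (\<mu> * real n) ^ m * (a n * l n)" for n
  have FA: "F \<in> class_X \<mu>" using assms(14,15) by (auto simp: class_X_def)
  have ge1: "1 \<le> \<mu> * real (n + 2)" for n
    using mult_mono[of 1 \<mu> 1 "real (n + 2)"] assms(1) by simp
  have pow1: "1 \<le> (\<mu> * real (n + 2)) ^ m" for n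
    by (rule one_le_power[OF ge1])
  have al: "0 \<le> a (n + 2) * l (n + 2)" and al_le: "a (n + 2) * l (n + 2) \<le> a (n + 2) * \<theta> (n + 2)" for n
    using assms(12,13,15) by (auto intro: mult_left_mono)
  have Q_ge: "a (n + 2) * l (n + 2) \<le> Q (n + 2)" for n
    unfolding Q_def using mult_right_mono[OF pow1 al] by simp
  have Q0: "0 \<le> Q (n + 2)" for n
    using al Q_ge by (rule order_trans)
  have QP: "Q (n + 2) \<le> P (n + 2)" for n
    unfolding P_def Q_def
    by (rule mult_mono[OF power_increasing[OF assms(8) ge1] al_le _ al])
      (use ge1[of n] in auto)
  define T where "T n = ((1 - B) * ((\<mu> * real n) ^ k * \<theta> n - (\<mu> * real n) ^ m * l n)
    + (A - B) * (1 - \<gamma>) * (\<mu> * real n) ^ m * \<theta> n) * a n" for n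
  have T: "(\<lambda>n. T (n + 2)) sums S" unfolding T_def by (rule assms(16))
  \<comment> \<open>The hypothesis weights the last term by \<open>\<theta>\<close>, the denominator of \<open>q\<close> only by \<open>l\<close>;
    \<open>l \<le> \<theta>\<close> bridges the gap.\<close>
  have T_ge: "(1 - B) * (P (n + 2) - Q (n + 2)) + c * Q (n + 2) \<le> T (n + 2)" for n
  proof -
    have "T (n + 2) = (1 - B) * (P (n + 2) - Q (n + 2))
        + c * ((\<mu> * real (n + 2)) ^ m * (a (n + 2) * \<theta> (n + 2)))"
      unfolding T_def P_def Q_def c_def by (simp only: algebra_simps)
    moreover have "c * Q (n + 2) \<le> c * ((\<mu> * real (n + 2)) ^ m * (a (n + 2) * \<theta> (n + 2)))"
      unfolding Q_def using c pow1[of n] by (intro mult_left_mono al_le) auto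
    ultimately show ?thesis by simp
  qed
  have B1: "0 < 1 - B" using assms(7) by simp
  \<comment> \<open>Both parts of the lower bound are nonnegative, so each series converges by comparison
    with \<open>T\<close> and the bound can be summed termwise.\<close>
  have Q_le: "Q (n + 2) \<le> T (n + 2) / c" and D_le: "P (n + 2) - Q (n + 2) \<le> T (n + 2) / (1 - B)" for n
  proof -
    have "0 \<le> (1 - B) * (P (n + 2) - Q (n + 2))" "0 \<le> c * Q (n + 2)"
      using B1 QP[of n] c Q0[of n] by simp_all
    then have "c * Q (n + 2) \<le> T (n + 2)" "(1 - B) * (P (n + 2) - Q (n + 2)) \<le> T (n + 2)"
      using T_ge[of n] by linarith+
    then show "Q (n + 2) \<le> T (n + 2) / c" "P (n + 2) - Q (n + 2) \<le> T (n + 2) / (1 - B)"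
      using c B1 by (simp_all only: pos_le_divide_eq mult.commute)
  qed
  have "summable (\<lambda>n. Q (n + 2))"
    by (rule summable_comparison_test'[OF summable_divide[OF sums_summable[OF T]]])
      (use Q0 Q_le in auto)
  then obtain V where V: "(\<lambda>n. Q (n + 2)) sums V" by (auto simp: summable_def)
  have "summable (\<lambda>n. P (n + 2) - Q (n + 2))"
    by (rule summable_comparison_test'[OF summable_divide[OF sums_summable[OF T]]])
      (use QP D_le in auto)
  then obtain U where U: "(\<lambda>n. P (n + 2) - Q (n + 2)) sums U" by (auto simp: summable_def)
  have "(\<lambda>n. (1 - B) * (P (n + 2) - Q (n + 2)) + c * Q (n + 2)) sums ((1 - B) * U + c * V)"
    by (intro sums_add sums_mult U V)
  from sums_le[OF T_ge this T] assms(17)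
  have main: "(1 - B) * U + c * V \<le> c" by (simp add: c_def)
  have "0 \<le> U" by (rule sums_le[OF _ sums_zero U]) (use QP in auto)
  then have "0 \<le> (1 - B) * U" using B1 by simp
  then have "c * V \<le> c * 1" using main by simp
  then have V1: "V \<le> 1" using c by (simp only: mult_le_cancel_left_pos)
  have "summable (\<lambda>n. a (n + 2) * l (n + 2))"
    by (rule summable_comparison_test'[OF sums_summable[OF V]]) (use al Q_ge in auto)
  then obtain W where W: "(\<lambda>n. a (n + 2) * l (n + 2)) sums W" by (auto simp: summable_def)
  have W1: "W \<le> 1" using sums_le[OF Q_ge W V] V1 by simp

  have conv: "mu_expansion \<mu> (\<lambda>n. - of_real (a n * l n)) (mu_conv \<mu> F \<Psi>)"
    using mu_expansion_conv[OF assms(14,10,1)] by simp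
  have M: "mu_expansion \<mu> (\<lambda>n. - of_real (Q n)) (mu_D \<mu> m (mu_conv \<mu> F \<Psi>))"
    using mu_expansion_D[OF conv assms(1), of m] by (simp add: Q_def)
  have N: "mu_expansion \<mu> (\<lambda>n. - of_real (P n)) (mu_D \<mu> k (mu_conv \<mu> F \<Phi>))"
    using mu_expansion_D[OF mu_expansion_conv[OF assms(14,9,1)] assms(1), of k] by (simp add: P_def)
  have "mu_conv \<mu> F \<Psi> z \<noteq> 0 \<and> mu_D \<mu> m (mu_conv \<mu> F \<Psi>) z \<noteq> 0 \<and>
      (let q = mu_D \<mu> k (mu_conv \<mu> F \<Phi>) z / mu_D \<mu> m (mu_conv \<mu> F \<Psi>) z;
           d = of_real ((A - B) * (1 - \<gamma>)) - of_real B * (q - 1)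
       in d \<noteq> 0 \<and> norm ((q - 1) / d) < 1)"
    if z: "0 < norm z" "norm z < 1" for z
  proof -
    let ?M = "mu_D \<mu> m (mu_conv \<mu> F \<Psi>) z" and ?N = "mu_D \<mu> k (mu_conv \<mu> F \<Phi>) z"
    have Ms: "(\<lambda>n. - of_real (Q (n + 2)) * z powr of_real (\<mu> * real (n + 2))) sums (?M - z)"
      using M z(2) unfolding mu_expansion_def by blast
    have Ns: "(\<lambda>n. - of_real (P (n + 2)) * z powr of_real (\<mu> * real (n + 2))) sums (?N - z)"
      using N z(2) unfolding mu_expansion_def by blast
    have NMs: "(\<lambda>n. - of_real (P (n + 2) - Q (n + 2)) * z powr of_real (\<mu> * real (n + 2))) sums (?N - ?M)"
      using sums_diff[OF Ns Ms] by (simp add: algebra_simps)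
    have NM: "norm (?N - ?M) \<le> U * norm z ^ 2"
      by (rule norm_tail_le[OF assms(1) z _ U NMs]) (use QP in simp)
    have "norm (?M - z) \<le> V * norm z ^ 2"
      by (rule norm_tail_le[OF assms(1) z Q0 V Ms])
    then have "norm z - V * norm z ^ 2 \<le> norm ?M"
      using norm_triangle_ineq2[of z ?M] norm_minus_commute[of z ?M] by linarith
    then have Mge: "c * (norm z - V * norm z ^ 2) \<le> c * norm ?M"
      using c by simp
    have "(1 - B) * norm (?N - ?M) \<le> (1 - B) * (U * norm z ^ 2)"
      using NM B1 by simp
    also have "\<dots> < c * (norm z - V * norm z ^ 2)"
    proof -
      have "((1 - B) * U + c * V) * norm z ^ 2 \<le> c * norm z ^ 2"
        by (rule mult_right_mono[OF main]) simp
      also have "\<dots> < c * norm z"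
        using c z by (simp add: power2_eq_square)
      finally show ?thesis by (simp add: algebra_simps)
    qed
    also note Mge
    finally have less: "(1 - B) * norm (?N - ?M) < c * norm ?M" .
    have "mu_conv \<mu> F \<Psi> z \<noteq> 0"
      by (rule mu_expansion_nonzero[OF assms(1) z al W W1 conv])
    moreover have "?M \<noteq> 0"
      by (rule mu_expansion_nonzero[OF assms(1) z Q0 V V1 M])
    ultimately show ?thesis
      using janowski_quotient_bound[OF _ _ less] assms(7) c
      unfolding Let_def c_def[symmetric] by auto
  qed
  then have "F \<in> class_E k m \<Phi> \<Psi> A B \<mu> \<gamma>"
    using FA class_X_subset_class_A unfolding class_E_def by blast
  then show ?thesis using FA by (simp add: class_E_tilde_def)
qed

end
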